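(* Every Heron triangle having two sides whose lengths are perfect squares corresponds, in the sense described below, to a non-trivial rational point $(X,Y)$ on the elliptic curve \[ \mathcal{E}_k:\ Y^2 = X^3 + \big(2(k^4-1)\big)^2 X \] for some rational number $k$ with $k^4\neq 1$, where the point satisfies \[ Y>\frac{2k\big(3X^3 - 2(3k^4 + 2k^2 + 3)X^2 + 4(k^4 - 1)^2X - 8(k^2 + 1)^2(k^2 - 1)^4\big)}{(X - 2(k^2 - 1)^2)^2 + 16k^2(k^2 - 1)^2}. \] Conversely, every such non-trivial rational point on $\mathcal{E}_k$ satisfying this inequality corresponds to a Heron triangle having two sides whose lengths are perfect squares.
   Context: A Heron triangle is a (non-degenerate) triangle whose three side lengths and whose area are all positive integers. The correspondence is as follows. A Heron triangle with two perfect-square sides is, after scaling by a positive rational factor, a triangle with side lengths $1$, $q^2$, $r$ with $q,r$ rational, $r>0$; placing it with vertices $(0,0)$, $(r,0)$, $(s,t)$ where $s^2+t^2=1$, $s=\frac{2k}{k^2+1}$, $t=\frac{k^2-1}{k^2+1}$ ($k$ rational), one has $q^4 = r^2 - \frac{4k}{k^2+1} r + 1$. A rational point $(X,Y)$ on $\mathcal{E}_k$ yields $(r,q)$ via \[ r=\frac{4(k^2+1)\,R(k,X,Y)}{\big(X-2(k^2+1)(k-1)^2\big)^2\big(X-2(k^2+1)(k+1)^2\big)^2},\qquad q=\frac{4Yk-X^2+4(k^4-1)^2}{\big(X-2(k^2+1)(k-1)^2\big)\big(X-2(k^2+1)(k+1)^2\big)}, \] where \[ R(k,X,Y)=\big((X-2(k^2-1)^2)^2+16k^2(k^2-1)^2\big)Y-2k\big(3X^3-2(3k^4+2k^2+3)X^2+4(k^4-1)^2X-8(k^2+1)^2(k^2-1)^4\big),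 \] and the triangle is the one with sides $1,q^2,r$ scaled to integers; conversely $(X,Y)$ is obtained from $(k,r,q)$ by the inverse birational change of variables. A non-trivial rational point means an affine rational point of $\mathcal{E}_k$ at which these formulas are defined and give $r\neq 0$. The inequality on $Y$ is equivalent to $r>0$. *)

theory Defs
  imports "HOL-Analysis.Analysis" "HOL-Library.Multiset"
begin

definition side_lengths :: "real^2 \<Rightarrow> real^2 \<Rightarrow> real^2 \<Rightarrow> real multiset" where
  "side_lengths A B C = {#dist A B, dist B C, dist C A#}"

definition heron_triangle :: "real^2 \<Rightarrow> real^2 \<Rightarrow> real^2 \<Rightarrow> bool" where
  "heron_triangle A B C \<longleftrightarrow>
     \<not> collinear {A, B, C} \<and>
     (\<forall>l \<in># side_lengths A B C. l \<in> \<nat> \<and> 0 < l) \<and>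
     measure lborel (convex hull {A, B, C}) \<in> \<nat> \<and> 0 < measure lborel (convex hull {A, B, C})"

definition perfect_square :: "real \<Rightarrow> bool" where
  "perfect_square x \<longleftrightarrow> (\<exists>n::nat. x = (real n)\<^sup>2)"

definition two_square_sides :: "real^2 \<Rightarrow> real^2 \<Rightarrow> real^2 \<Rightarrow> bool" where
  "two_square_sides A B C \<longleftrightarrow>
     perfect_square (dist A B) \<and> perfect_square (dist B C) \<or>
     perfect_square (dist B C) \<and> perfect_square (dist C A) \<or>
     perfect_square (dist C A) \<and> perfect_square (dist A B)"

definition on_curve :: "rat \<Rightarrow> rat \<Rightarrow> rat \<Rightarrow> bool" where
  "on_curve k X Y \<longleftrightarrow> Y^2 = X^3 + (2 * (k^4 - 1))^2 * X"

definition poly_R :: "rat \<Rightarrow> rat \<Rightarrow> rat \<Rightarrow> rat" where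
  "poly_R k X Y =
     ((X - 2 * (k^2 - 1)^2)^2 + 16 * k^2 * (k^2 - 1)^2) * Y
     - 2 * k * (3 * X^3 - 2 * (3 * k^4 + 2 * k^2 + 3) * X^2 + 4 * (k^4 - 1)^2 * X
                - 8 * (k^2 + 1)^2 * (k^2 - 1)^4)"

definition denom :: "rat \<Rightarrow> rat \<Rightarrow> rat" where
  "denom k X = (X - 2 * (k^2 + 1) * (k - 1)^2) * (X - 2 * (k^2 + 1) * (k + 1)^2)"

definition r_of :: "rat \<Rightarrow> rat \<Rightarrow> rat \<Rightarrow> rat" where
  "r_of k X Y = 4 * (k^2 + 1) * poly_R k X Y / (denom k X)^2"

definition q_of :: "rat \<Rightarrow> rat \<Rightarrow> rat \<Rightarrow> rat" where
  "q_of k X Y = (4 * Y * k - X^2 + 4 * (k^4 - 1)^2) / denom k X"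

definition nontrivial_point :: "rat \<Rightarrow> rat \<Rightarrow> rat \<Rightarrow> bool" where
  "nontrivial_point k X Y \<longleftrightarrow> on_curve k X Y \<and> denom k X \<noteq> 0 \<and> r_of k X Y \<noteq> 0"

definition apex :: "rat \<Rightarrow> real^2" where
  "apex k = vector [of_rat (2 * k / (k^2 + 1)), of_rat ((k^2 - 1) / (k^2 + 1))]"

text \<open>
  The placed triangle has vertices \<open>P = (0,0)\<close>, \<open>Q = (r,0)\<close>, \<open>S = (s,t)\<close>; \<open>A B C\<close> is that triangle
  scaled by \<open>\<mu>\<close>, up to congruence and the labelling of its vertices. Only \<open>q\<^sup>2\<close> is a side, so the
  sign of \<open>q\<close> is not determined by the triangle.
\<close>

definition corresponds ::
  "real^2 \<Rightarrow> real^2 \<Rightarrow> real^2 \<Rightarrow> rat \<Rightarrow> rat \<Rightarrow> rat \<Rightarrow> bool" where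
  "corresponds A B C k X Y \<longleftrightarrow>
     (let r = of_rat (r_of k X Y) :: real;
          q = of_rat (q_of k X Y) :: real;
          P = vector [0, 0] :: real^2;
          Q = vector [r, 0] :: real^2;
          S = apex k
      in dist P S = 1 \<and> dist S Q = q\<^sup>2 \<and> dist P Q = r \<and>
         (\<exists>\<mu>::rat. 0 < \<mu> \<and>
            side_lengths A B C = image_mset ((*) (of_rat \<mu>)) {#1, q\<^sup>2, r#}))"

end

theory Submission
  imports Defs
begin

text \<open>
  Put \<open>s = 2k/(k\<^sup>2+1)\<close>, \<open>t = (k\<^sup>2-1)/(k\<^sup>2+1)\<close>, \<open>w = r - s\<close>. The cosine rule for the placed triangle is
  the quartic \<open>w\<^sup>2 = q\<^sup>4 - t\<^sup>2\<close>. With \<open>X = 2(k\<^sup>2+1)\<^sup>2 x\<close> and \<open>Y = 4(k\<^sup>2+1)\<^sup>3 y\<close> the elliptic curve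
  becomes \<open>2y\<^sup>2 = x\<^sup>3 + t\<^sup>2 x\<close>, and the birational map sends the point at infinity to
  \<open>(q, w) = (-1, -s)\<close>. A triangle determines \<open>q\<close> only up to sign, and this freedom is what avoids the
  points where the formulas for \<open>(r, q)\<close> are undefined: if both signs were exceptional, \<open>\<surd>2\<close> would be
  rational. The remaining conditions translate directly: \<open>s\<close> and \<open>t\<close> are the cosine and, up to sign, the
  sine of the angle between the sides \<open>1\<close> and \<open>r\<close>, so \<open>t\<close> is rational because the area is, and the
  bound on \<open>Y\<close> says \<open>r > 0\<close>.
\<close>

section \<open>The curve in normalised coordinates\<close>

definition on_cubic :: "'a::field \<Rightarrow> 'a \<Rightarrow> 'a \<Rightarrow> bool" where
  "on_cubic t x y \<longleftrightarrow> 2 * y^2 = x^3 + t^2 * x"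

definition on_quartic :: "'a::field \<Rightarrow> 'a \<Rightarrow> 'a \<Rightarrow> bool" where
  "on_quartic t q w \<longleftrightarrow> w^2 = q^4 - t^2"

definition chart_denom :: "'a::field \<Rightarrow> 'a \<Rightarrow> 'a" where
  "chart_denom t x = x^2 - 2 * x + t^2"

definition q_numer :: "'a::field \<Rightarrow> 'a \<Rightarrow> 'a \<Rightarrow> 'a \<Rightarrow> 'a" where
  "q_numer s t x y = 2 * s * y - x^2 + t^2"

definition w_numer :: "'a::field \<Rightarrow> 'a \<Rightarrow> 'a \<Rightarrow> 'a \<Rightarrow> 'a" where
  "w_numer s t x y = 4 * (x^2 - 2 * t^2 * x + t^2) * y - s * (x^2 - t^2) * (x^2 + 2 * x + t^2)"

definition abscissa :: "'a::field \<Rightarrow> 'a \<Rightarrow> 'a \<Rightarrow> 'a \<Rightarrow> 'a" where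
  "abscissa s t q w = (q^2 - s * w - t^2) / (q + 1)^2"

definition ordinate :: "'a::field \<Rightarrow> 'a \<Rightarrow> 'a \<Rightarrow> 'a \<Rightarrow> 'a" where
  "ordinate s t q w = (w * (q + t^2) - s * (q^3 + t^2)) / (q + 1)^3"

lemma on_cubic_imp_on_quartic:
  assumes "s^2 + t^2 = 1" "on_cubic t x y" "chart_denom t x \<noteq> 0"
  shows "on_quartic t (q_numer s t x y / chart_denom t x) (w_numer s t x y / (chart_denom t x)^2)"
proof -
  have "(w_numer s t x y)^2 = (q_numer s t x y)^4 - t^2 * (chart_denom t x)^4"
    using assms(1,2) unfolding on_cubic_def chart_denom_def q_numer_def w_numer_def by algebra
  then show ?thesis
    using assms(3) unfolding on_quartic_def by (simp add: field_simps)
qed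

lemma abscissa_mult:
  assumes "q \<noteq> -1"
  shows "abscissa s t q w * (q + 1)^2 = q^2 - s * w - t^2"
  using assms by (simp add: abscissa_def add_eq_0_iff2)

lemma ordinate_mult:
  assumes "q \<noteq> -1"
  shows "ordinate s t q w * (q + 1)^3 = w * (q + t^2) - s * (q^3 + t^2)"
  using assms by (simp add: ordinate_def add_eq_0_iff2)

lemma
  assumes st: "s^2 + t^2 = 1" and quartic: "on_quartic t q w" and q: "q \<noteq> -1"
  defines "x \<equiv> abscissa s t q w" and "y \<equiv> ordinate s t q w"
  shows on_cubic_abscissa_ordinate: "on_cubic t x y"
    and q_numer_abscissa_ordinate: "q_numer s t x y = q * chart_denom t x"
    and w_numer_abscissa_ordinate: "w_numer s t x y = w * (chart_denom t x)^2"
proof -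
  define p where "p = q + 1"
  have p_nonzero: "p \<noteq> 0" using q by (simp add: p_def add_eq_0_iff2)
  have w_power2: "w^2 = q^4 - t^2" using quartic by (simp add: on_quartic_def)
  define N where "N = q^2 - s * w - t^2"
  define M where "M = w * (q + t^2) - s * (q^3 + t^2)"
  have N_eq: "N = x * p^2" and M_eq: "M = y * p^3"
    using abscissa_mult[OF q, of s t w] ordinate_mult[OF q, of s t w]
    by (simp_all add: x_def y_def p_def N_def M_def)
  have "2 * M^2 = N^3 + t^2 * N * p^4"
    using st w_power2 N_def M_def p_def by algebra
  then have "p^6 * (2 * y^2) = p^6 * (x^3 + t^2 * x)"
    unfolding N_eq M_eq by algebra
  then show "on_cubic t x y" using p_nonzero by (simp add: on_cubic_def)
  have "2 * s * M * p - N^2 + t^2 * p^4 = q * (N^2 - 2 * N * p^2 + t^2 * p^4)"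
    using st w_power2 N_def M_def p_def by algebra
  then have "p^4 * q_numer s t x y = p^4 * (q * chart_denom t x)"
    unfolding q_numer_def chart_denom_def N_eq M_eq by algebra
  then show "q_numer s t x y = q * chart_denom t x" using p_nonzero by simp
  have "4 * (N^2 - 2 * t^2 * N * p^2 + t^2 * p^4) * M * p
      - s * (N^2 - t^2 * p^4) * (N^2 + 2 * N * p^2 + t^2 * p^4)
      = w * (N^2 - 2 * N * p^2 + t^2 * p^4)^2"
    using st w_power2 N_def M_def p_def by algebra
  then have "p^8 * w_numer s t x y = p^8 * (w * (chart_denom t x)^2)"
    unfolding w_numer_def chart_denom_def N_eq M_eq by algebra
  then show "w_numer s t x y = w * (chart_denom t x)^2" using p_nonzero by simp
qed

lemma on_quartic_diff_iff:
  assumes "s^2 + t^2 = 1"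
  shows "on_quartic t q (r - s) \<longleftrightarrow> q^4 = r^2 - 2 * s * r + 1"
  using assms unfolding on_quartic_def by algebra

section \<open>Exceptional points of the birational map\<close>

lemma chart_denom_abscissa_eq_0E:
  fixes s t q w :: "'a::field_char_0"
  assumes st: "s^2 + t^2 = 1" and t: "t \<noteq> 0" and quartic: "on_quartic t q w" and q: "q \<noteq> -1"
    and pole: "chart_denom t (abscissa s t q w) = 0"
  obtains u where "u^2 = s^2" "abscissa s t q w = 1 - u" "2 * u * q = 1 + t^2"
proof
  define u where "u = 1 - abscissa s t q w"
  show x_eq: "abscissa s t q w = 1 - u" by (simp add: u_def)
  show u_power2: "u^2 = s^2" using pole st unfolding x_eq chart_denom_def by algebra
  have w_power2: "w^2 = q^4 - t^2" using quartic by (simp add: on_quartic_def)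
  have numerator: "(1 - u) * (q + 1)^2 = q^2 - s * w - t^2"
    using abscissa_mult[OF q, of s t w] by (simp add: x_eq)
  \<comment> \<open>Eliminating \<open>w\<close> by \<open>w\<^sup>2 = q\<^sup>4 - t\<^sup>2\<close> leaves a cubic in \<open>q\<close> with the double root \<open>-1\<close>.\<close>
  have "2 * (1 - u) * (q + 1)^2 * (2 * u * q - (1 + t^2)) = 0"
    using numerator st u_power2 w_power2 by algebra
  moreover have "1 - u \<noteq> 0"
    using u_power2 st t by auto
  moreover have "q + 1 \<noteq> 0" using q by (simp add: add_eq_0_iff2)
  ultimately show "2 * u * q = 1 + t^2" by simp
qed

lemma Rats_power_Ints_imp_Ints:
  fixes x :: "'a::field_char_0"
  assumes "x \<in> \<rat>" "x ^ n \<in> \<int>" "n > 0"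
  shows "x \<in> \<int>"
proof -
  have "algebraic_int x"
  proof (rule algebraic_int_root)
    show "algebraic_int (x ^ n)" using assms(2) by (rule int_imp_algebraic_int)
    show "poly (monom 1 n) x = x ^ n" by (simp add: poly_monom)
  qed (use assms(3) in \<open>auto simp: degree_monom_eq\<close>)
  then show ?thesis
    using assms(1) rational_algebraic_int_is_int by blast
qed

lemma rat_power2_neq_2: "(z::rat)^2 \<noteq> 2"
proof
  assume z: "z^2 = 2"
  have "z \<in> \<rat>" using Rats_of_rat[of z, where 'a = rat] by simp
  then have "z \<in> \<int>" by (rule Rats_power_Ints_imp_Ints[of z 2]) (simp_all add: z)
  then obtain i where "z = of_int i" by (elim Ints_cases)
  then have "i^2 = 2" using z by (metis of_int_eq_iff of_int_numeral of_int_power)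
  then show False
    using abs_le_square_iff[of i 1] abs_le_square_iff[of 2 i] by auto
qed

lemma ex_sign_chart_denom_abscissa_nonzero:
  fixes s t q w :: rat
  assumes st: "s^2 + t^2 = 1" and t: "t \<noteq> 0" and quartic: "on_quartic t q w"
    and degenerate: "q^2 = 1 \<Longrightarrow> w \<noteq> -s"
  shows "\<exists>p. p^2 = q^2 \<and> p \<noteq> -1 \<and> chart_denom t (abscissa s t p w) \<noteq> 0"
proof (cases "q^2 = 1")
  case True
  then have "w^2 = s^2" using quartic st unfolding on_quartic_def by algebra
  then have "w = s" using degenerate True by (auto simp: power2_eq_iff)
  then have "abscissa s t 1 w = 0"
    using st by (simp add: abscissa_def flip: power2_eq_square)
  then show ?thesis using True t by (intro exI[of _ 1]) (simp add: chart_denom_def)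
next
  case False
  then have q: "q \<noteq> -1" "- q \<noteq> -1" by auto
  have quartic': "on_quartic t (- q) w" using quartic by (simp add: on_quartic_def)
  have "chart_denom t (abscissa s t q w) \<noteq> 0 \<or> chart_denom t (abscissa s t (- q) w) \<noteq> 0"
  proof (rule ccontr)
    assume "\<not> ?thesis"
    then obtain u v where u: "u^2 = s^2" "abscissa s t q w = 1 - u" "2 * u * q = 1 + t^2"
      and v: "v^2 = s^2" "abscissa s t (- q) w = 1 - v" "2 * v * (- q) = 1 + t^2"
      using chart_denom_abscissa_eq_0E[OF st t quartic q(1)]
        chart_denom_abscissa_eq_0E[OF st t quartic' q(2)] by metis
    have "1 + t^2 \<noteq> 0" using zero_le_power2[of t] by linarith
    then have "v \<noteq> u" using u(3) v(3) by auto
    then have "v = - u" using u(1) v(1) by (metis power2_eq_iff)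
    then have "(1 - u) * (q + 1)^2 = (1 + u) * (- q + 1)^2"
      using abscissa_mult[OF q(1), of s t w] abscissa_mult[OF q(2), of s t w] u(2) v(2) by simp
    then have "u * (q^2 + 1) = 2 * q" by algebra
    then have "(u^2 + 2)^2 = 8" using u(1,3) st by algebra
    then have "((u^2 + 2) / 2)^2 = 2" by (simp add: power_divide)
    then show False using rat_power2_neq_2 by blast
  qed
  then show ?thesis using q by (metis power2_minus)
qed

section \<open>Rational points and the cosine rule\<close>

definition circle_x :: "'a::linordered_field \<Rightarrow> 'a" where
  "circle_x k = 2 * k / (k^2 + 1)"

definition circle_y :: "'a::linordered_field \<Rightarrow> 'a" where
  "circle_y k = (k^2 - 1) / (k^2 + 1)"

lemma power2_plus_1_pos: "0 < k^2 + (1::'a::linordered_idom)"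
  by (simp add: add_nonneg_pos)

lemma circle_x_mult: "circle_x k * (k^2 + 1) = 2 * k"
  using power2_plus_1_pos[of k] by (simp add: circle_x_def)

lemma circle_y_mult: "circle_y k * (k^2 + 1) = k^2 - 1"
  using power2_plus_1_pos[of k] by (simp add: circle_y_def)

lemma circle_x_y_unit: "(circle_x k)^2 + (circle_y k)^2 = 1"
proof -
  have "(k^2 + 1)^2 * ((circle_x k)^2 + (circle_y k)^2) = (k^2 + 1)^2 * 1"
    using circle_x_mult[of k] circle_y_mult[of k] by algebra
  then show ?thesis using power2_plus_1_pos[of k] by simp
qed

lemma circle_y_eq_0_iff: "circle_y k = 0 \<longleftrightarrow> k^4 = 1"
proof -
  have "circle_y k = 0 \<longleftrightarrow> k^2 = 1"
    using power2_plus_1_pos[of k] by (simp add: circle_y_def)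
  also have "\<dots> \<longleftrightarrow> k^4 = 1"
    using power2_eq_1_iff[of "k^2"] zero_le_power2[of k] by (auto simp flip: power_mult)
  finally show ?thesis .
qed

lemma unit_circle_param:
  fixes s t :: "'a::linordered_field"
  assumes st: "s^2 + t^2 = 1" and t: "t \<noteq> 1"
  obtains k where "circle_x k = s" "circle_y k = t"
proof
  define k where "k = s / (1 - t)"
  have k_mult: "k * (1 - t) = s" using t by (simp add: k_def)
  have "(1 - t) * ((k^2 + 1) * (1 - t)) = (k * (1 - t))^2 + (1 - t)^2" by algebra
  also have "\<dots> = (1 - t) * 2" unfolding k_mult using st by algebra
  finally have norm_mult: "(k^2 + 1) * (1 - t) = 2"
    by (rule mult_left_cancel[THEN iffD1, rotated]) (use t in simp)
  have "k^2 + 1 \<noteq> 0" using power2_plus_1_pos[of k] by simp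
  moreover have "s * (k^2 + 1) = k * ((k^2 + 1) * (1 - t))"
    by (simp flip: k_mult)
  moreover have "t * (k^2 + 1) = (k^2 + 1) - (k^2 + 1) * (1 - t)"
    by (simp add: algebra_simps)
  ultimately show "circle_x k = s" "circle_y k = t"
    by (simp_all add: circle_x_def circle_y_def divide_eq_eq norm_mult)
qed

definition curve_X :: "rat \<Rightarrow> rat \<Rightarrow> rat" where
  "curve_X k x = 2 * (k^2 + 1)^2 * x"

definition curve_Y :: "rat \<Rightarrow> rat \<Rightarrow> rat" where
  "curve_Y k y = 4 * (k^2 + 1)^3 * y"

lemma curve_coordinates_surj:
  obtains x y where "X = curve_X k x" "Y = curve_Y k y"
proof
  show "X = curve_X k (X / (2 * (k^2 + 1)^2))" "Y = curve_Y k (Y / (4 * (k^2 + 1)^3))"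
    using power2_plus_1_pos[of k] by (simp_all add: curve_X_def curve_Y_def)
qed

lemma power4_minus_1_eq_circle_y: "k^4 - 1 = (k^2 + 1)^2 * circle_y k"
  using circle_y_mult[of k] by algebra

lemma on_curve_iff_on_cubic:
  "on_curve k (curve_X k x) (curve_Y k y) \<longleftrightarrow> on_cubic (circle_y k) x y"
proof -
  have "(curve_Y k y)^2 - ((curve_X k x)^3 + (2 * (k^4 - 1))^2 * curve_X k x)
      = 8 * (k^2 + 1)^6 * (2 * y^2 - (x^3 + (circle_y k)^2 * x))"
    unfolding power4_minus_1_eq_circle_y curve_X_def curve_Y_def by algebra
  moreover have "8 * (k^2 + 1)^6 \<noteq> 0" using power2_plus_1_pos[of k] by simp
  ultimately show ?thesis
    unfolding on_curve_def on_cubic_def by (metis eq_iff_diff_eq_0 mult_eq_0_iff)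
qed

lemma denom_curve_X: "denom k (curve_X k x) = 4 * (k^2 + 1)^4 * chart_denom (circle_y k) x"
proof -
  have "2 * (k^2 + 1) * (k - 1)^2 = 2 * (k^2 + 1)^2 * (1 - circle_x k)"
    and "2 * (k^2 + 1) * (k + 1)^2 = 2 * (k^2 + 1)^2 * (1 + circle_x k)"
    using circle_x_mult[of k] by algebra+
  then have "denom k (curve_X k x) = 4 * (k^2 + 1)^4 * ((x - 1)^2 - (circle_x k)^2)"
    unfolding denom_def curve_X_def by algebra
  also have "(x - 1)^2 - (circle_x k)^2 = chart_denom (circle_y k) x"
    unfolding chart_denom_def using circle_x_y_unit[of k] by algebra
  finally show ?thesis .
qed

lemma denom_curve_X_eq_0_iff: "denom k (curve_X k x) = 0 \<longleftrightarrow> chart_denom (circle_y k) x = 0"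
  using power2_plus_1_pos[of k] by (simp add: denom_curve_X)

lemma q_of_curve_coordinates:
  "q_of k (curve_X k x) (curve_Y k y)
    = q_numer (circle_x k) (circle_y k) x y / chart_denom (circle_y k) x"
proof -
  have "4 * curve_Y k y * k - (curve_X k x)^2 + 4 * (k^4 - 1)^2
      = 4 * (k^2 + 1)^4 * q_numer (circle_x k) (circle_y k) x y"
    unfolding power4_minus_1_eq_circle_y curve_X_def curve_Y_def q_numer_def
    using circle_x_mult[of k] by algebra
  then show ?thesis
    using power2_plus_1_pos[of k] by (simp add: q_of_def denom_curve_X)
qed

lemma poly_R_curve_coordinates:
  "poly_R k (curve_X k x) (curve_Y k y) = 4 * (k^2 + 1)^7 *
    (circle_x k * (chart_denom (circle_y k) x)^2 + w_numer (circle_x k) (circle_y k) x y)"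
proof -
  define a s t where "a = k^2 + 1" and "s = circle_x k" and "t = circle_y k"
  have s_mult: "s * a = 2 * k" and t_mult: "t * a = k^2 - 1" and st: "s^2 + t^2 = 1"
    and k_power4: "k^4 - 1 = a^2 * t" and a_eq: "k^2 + 1 = a"
    using circle_x_mult[of k] circle_y_mult[of k] circle_x_y_unit[of k]
      power4_minus_1_eq_circle_y[of k] by (simp_all add: a_def s_def t_def)
  have Y_coeff: "(2 * a^2 * x - 2 * (k^2 - 1)^2)^2 + 16 * k^2 * (k^2 - 1)^2
      = 4 * a^4 * (x^2 - 2 * t^2 * x + t^2)"
    unfolding t_mult[symmetric] using s_mult st by algebra
  have X2_coeff: "3 * k^4 + 2 * k^2 + 3 = a^2 * (2 + t^2)"
    using a_def t_mult by algebra
  have "poly_R k (curve_X k x) (curve_Y k y)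
      = 8 * a^7 * (2 * (x^2 - 2 * t^2 * x + t^2) * y
          - s * (3 * x^3 - (2 + t^2) * x^2 + t^2 * x - t^4))"
    unfolding poly_R_def curve_X_def curve_Y_def a_eq Y_coeff X2_coeff k_power4
    unfolding t_mult[symmetric] s_mult[symmetric] by algebra
  also have "\<dots> = 4 * a^7 * (s * (chart_denom t x)^2 + w_numer s t x y)"
    unfolding chart_denom_def w_numer_def by algebra
  finally show ?thesis by (simp add: a_def s_def t_def)
qed

lemma r_of_curve_coordinates:
  assumes "chart_denom (circle_y k) x \<noteq> 0"
  shows "r_of k (curve_X k x) (curve_Y k y)
    = circle_x k + w_numer (circle_x k) (circle_y k) x y / (chart_denom (circle_y k) x)^2"
proof -
  define a where "a = k^2 + 1"
  define d where "d = chart_denom (circle_y k) x"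
  define V where "V = circle_x k * d^2 + w_numer (circle_x k) (circle_y k) x y"
  have "r_of k (curve_X k x) (curve_Y k y) = 4 * a * (4 * a^7 * V) / (4 * a^4 * d)^2"
    by (simp add: r_of_def poly_R_curve_coordinates denom_curve_X a_def d_def V_def)
  also have "4 * a * (4 * a^7 * V) = (4 * a^4)^2 * V" by algebra
  also have "(4 * a^4)^2 * V / (4 * a^4 * d)^2 = ((4 * a^4)^2 * V) / ((4 * a^4)^2 * d^2)"
    by (simp only: power_mult_distrib[of "4 * a^4"])
  also have "\<dots> = V / d^2"
    using power2_plus_1_pos[of k] by (intro mult_divide_mult_cancel_left) (simp add: a_def)
  finally show ?thesis
    using assms by (simp add: V_def d_def add_divide_distrib)
qed

lemma cosine_rule_of_point:
  assumes curve: "on_curve k X Y" and denom: "denom k X \<noteq> 0"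
  shows "(q_of k X Y)^4 = (r_of k X Y)^2 - 2 * circle_x k * r_of k X Y + 1"
proof -
  obtain x y where XY: "X = curve_X k x" "Y = curve_Y k y"
    by (rule curve_coordinates_surj)
  have d: "chart_denom (circle_y k) x \<noteq> 0"
    using denom by (simp add: XY denom_curve_X_eq_0_iff)
  have "on_quartic (circle_y k) (q_of k X Y) (r_of k X Y - circle_x k)"
    using on_cubic_imp_on_quartic[OF circle_x_y_unit _ d] curve d
    by (simp add: XY on_curve_iff_on_cubic q_of_curve_coordinates r_of_curve_coordinates)
  then show ?thesis using on_quartic_diff_iff[OF circle_x_y_unit] by blast
qed

lemma point_of_cosine_rule:
  fixes k q r :: rat
  assumes k: "k^4 \<noteq> 1" and r: "r \<noteq> 0" and cosine: "q^4 = r^2 - 2 * circle_x k * r + 1"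
  obtains X Y where "on_curve k X Y" "denom k X \<noteq> 0" "r_of k X Y = r" "(q_of k X Y)^2 = q^2"
proof -
  define s t w where "s = circle_x k" and "t = circle_y k" and "w = r - circle_x k"
  have st: "s^2 + t^2 = 1" and t: "t \<noteq> 0"
    using k by (simp_all add: s_def t_def circle_x_y_unit circle_y_eq_0_iff)
  have "on_quartic t q w"
    using cosine on_quartic_diff_iff[OF st, of q r] by (simp add: s_def w_def)
  moreover have "w \<noteq> - s" using r by (simp add: w_def s_def)
  ultimately obtain p where p: "p^2 = q^2" "p \<noteq> -1" "chart_denom t (abscissa s t p w) \<noteq> 0"
    using ex_sign_chart_denom_abscissa_nonzero[OF st t] by blast
  have "on_quartic t p w"
    using \<open>on_quartic t q w\<close> p(1) unfolding on_quartic_def by algebra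
  note p_point = st this p(2)
  define X Y where "X = curve_X k (abscissa s t p w)" and "Y = curve_Y k (ordinate s t p w)"
  show thesis
  proof
    show "on_curve k X Y"
      using on_cubic_abscissa_ordinate[OF p_point]
      by (simp add: X_def Y_def on_curve_iff_on_cubic flip: t_def)
    show "denom k X \<noteq> 0"
      using p(3) by (simp add: X_def denom_curve_X_eq_0_iff flip: t_def)
    have "q_of k X Y = p"
      using q_numer_abscissa_ordinate[OF p_point] p(3)
      by (simp add: X_def Y_def q_of_curve_coordinates flip: s_def t_def)
    then show "(q_of k X Y)^2 = q^2" using p(1) by simp
    have "r_of k X Y = s + w"
      using w_numer_abscissa_ordinate[OF p_point] p(3)
      by (simp add: X_def Y_def r_of_curve_coordinates flip: s_def t_def)
    then show "r_of k X Y = r" by (simp add: w_def s_def)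
  qed
qed

lemma Y_bound_denom_pos:
  fixes k X :: rat
  assumes k: "k^4 \<noteq> 1" and denom: "denom k X \<noteq> 0"
  shows "(X - 2 * (k^2 - 1)^2)^2 + 16 * k^2 * (k^2 - 1)^2 > 0"
proof -
  have "X - 2 * (k^2 - 1)^2 \<noteq> 0 \<or> 4 * k * (k^2 - 1) \<noteq> 0"
  proof (rule ccontr)
    assume "\<not> ?thesis"
    moreover have "k^2 - 1 \<noteq> 0" using k by algebra
    ultimately have "k = 0" "X = 2" by auto
    then show False using denom by (simp add: denom_def)
  qed
  then have "(X - 2 * (k^2 - 1)^2)^2 + (4 * k * (k^2 - 1))^2 > 0"
    by (simp only: sum_power2_gt_zero_iff)
  then show ?thesis by (simp add: power_mult_distrib)
qed

lemma r_of_pos_iff: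
  assumes "denom k X \<noteq> 0"
  shows "r_of k X Y > 0 \<longleftrightarrow> poly_R k X Y > 0"
  using assms power2_plus_1_pos[of k]
  by (auto simp: r_of_def zero_less_divide_iff zero_less_mult_iff not_less_iff_gr_or_eq)

definition triangle_point :: "rat \<Rightarrow> rat \<Rightarrow> rat \<Rightarrow> bool" where
  "triangle_point k X Y \<longleftrightarrow> k^4 \<noteq> 1 \<and> on_curve k X Y \<and> denom k X \<noteq> 0 \<and> r_of k X Y > 0"

lemma triangle_point_iff_Y_bound:
  "triangle_point k X Y \<longleftrightarrow> k^4 \<noteq> 1 \<and> nontrivial_point k X Y \<and>
     Y > 2 * k * (3 * X^3 - 2 * (3 * k^4 + 2 * k^2 + 3) * X^2 + 4 * (k^4 - 1)^2 * X
                  - 8 * (k^2 + 1)^2 * (k^2 - 1)^4)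
         / ((X - 2 * (k^2 - 1)^2)^2 + 16 * k^2 * (k^2 - 1)^2)"
  (is "_ \<longleftrightarrow> _ \<and> _ \<and> ?bound")
proof -
  have "?bound \<longleftrightarrow> r_of k X Y > 0" if "k^4 \<noteq> 1" "denom k X \<noteq> 0"
    unfolding r_of_pos_iff[OF that(2)] poly_R_def pos_divide_less_eq[OF Y_bound_denom_pos[OF that]]
    by (simp add: mult.commute)
  then show ?thesis unfolding triangle_point_def nontrivial_point_def by auto
qed

section \<open>Plane triangles\<close>

abbreviation triangle_area :: "real^2 \<Rightarrow> real^2 \<Rightarrow> real^2 \<Rightarrow> real" where
  "triangle_area A B C \<equiv> measure lborel (convex hull {A, B, C})"

lemma dist_real2_power2: "(dist A B)^2 = (A$1 - B$1)^2 + (A$2 - B$2)^2" for A B :: "real^2"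
  by (simp add: dist_vec_def L2_set_def sum_2 dist_real_def)

lemma triangle_area_power2:
  fixes A B C :: "real^2"
  shows "16 * (triangle_area A B C)^2 =
    4 * (dist A B)^2 * (dist C A)^2 - ((dist A B)^2 + (dist C A)^2 - (dist B C)^2)^2"
proof -
  have "16 * (triangle_area A B C)^2 =
      4 * ((C$1 - A$1) * (B$2 - A$2) - (B$1 - A$1) * (C$2 - A$2))^2"
    by (simp add: content_triangle power_divide)
  also have "\<dots> = 4 * (dist A B)^2 * (dist C A)^2 - ((dist A B)^2 + (dist C A)^2 - (dist B C)^2)^2"
    unfolding dist_real2_power2 by algebra
  finally show ?thesis .
qed

lemma triangle_area_eq_0_if_collinear:
  fixes A B C :: "real^2"
  assumes "collinear {A, B, C}"
  shows "triangle_area A B C = 0"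
proof -
  obtain u where u: "\<And>P Q. P \<in> {A, B, C} \<Longrightarrow> Q \<in> {A, B, C} \<Longrightarrow> \<exists>c. P - Q = c *\<^sub>R u"
    using assms unfolding collinear_def by blast
  obtain b c where "B - A = b *\<^sub>R u" "C - A = c *\<^sub>R u"
    using u[of B A] u[of C A] by auto
  then have "B = A + b *\<^sub>R u" "C = A + c *\<^sub>R u" by (simp_all add: algebra_simps)
  then show ?thesis by (simp add: content_triangle algebra_simps)
qed

lemma triangle_area_scaleR:
  fixes A B C :: "real^2"
  shows "triangle_area (c *\<^sub>R A) (c *\<^sub>R B) (c *\<^sub>R C) = c^2 * triangle_area A B C"
proof -
  have "(c * C$1 - c * A$1) * (c * B$2 - c * A$2) - (c * B$1 - c * A$1) * (c * C$2 - c * A$2)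
      = c^2 * ((C$1 - A$1) * (B$2 - A$2) - (B$1 - A$1) * (C$2 - A$2))"
    by algebra
  then show ?thesis by (simp add: content_triangle abs_mult)
qed

lemma dist_scaleR_scaleR: "dist (c *\<^sub>R x) (c *\<^sub>R y) = \<bar>c\<bar> * dist x y"
  for x y :: "'a::real_normed_vector"
  by (simp add: dist_norm flip: scaleR_diff_right)

lemma side_lengths_scaleR:
  assumes "c \<ge> 0"
  shows "side_lengths (c *\<^sub>R A) (c *\<^sub>R B) (c *\<^sub>R C) = image_mset ((*) c) (side_lengths A B C)"
  using assms by (simp add: side_lengths_def dist_scaleR_scaleR)

lemma side_lengths_rotate: "side_lengths B C A = side_lengths A B C"
  by (simp add: side_lengths_def add_mset_commute)

lemma heron_triangle_rotate: "heron_triangle B C A \<longleftrightarrow> heron_triangle A B C"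
  by (simp add: heron_triangle_def side_lengths_rotate insert_commute)

lemma corresponds_rotate: "corresponds B C A = corresponds A B C"
  by (intro ext) (simp add: corresponds_def side_lengths_rotate)

lemma cosine_sine_of_sides:
  fixes a b c f :: "'a::field_char_0"
  assumes heron: "16 * f^2 = 4 * a^2 * c^2 - (a^2 + c^2 - b^2)^2" and "a \<noteq> 0" "c \<noteq> 0"
  shows "((a^2 + c^2 - b^2) / (2 * a * c))^2 + (2 * f / (a * c))^2 = 1"
proof -
  have "((a^2 + c^2 - b^2) / (2 * a * c))^2 + (2 * f / (a * c))^2
      = ((a^2 + c^2 - b^2)^2 + 16 * f^2) / (4 * a^2 * c^2)"
    using assms(2,3) by (simp add: field_simps)
  then show ?thesis using assms(2,3) unfolding heron by simp
qed

lemma dist_apex_power2: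
  "(dist (apex k) (vector [of_rat r, 0]))^2 = of_rat (r^2 - 2 * circle_x k * r + 1)"
proof -
  have "(dist (apex k) (vector [of_rat r, 0]))^2 = of_rat ((circle_x k - r)^2 + (circle_y k)^2)"
    by (simp add: dist_real2_power2 apex_def of_rat_add of_rat_power of_rat_diff
        flip: circle_x_def circle_y_def)
  also have "(circle_x k - r)^2 + (circle_y k)^2 = r^2 - 2 * circle_x k * r + 1"
    using circle_x_y_unit[of k] by algebra
  finally show ?thesis .
qed

lemma
  assumes "on_curve k X Y" "denom k X \<noteq> 0"
  shows dist_origin_apex: "dist (vector [0, 0]) (apex k) = 1"
    and dist_apex_r_of: "dist (apex k) (vector [of_rat (r_of k X Y), 0]) = (of_rat (q_of k X Y))\<^sup>2"
proof -
  have "(dist (vector [0, 0]) (apex k))^2 = 1^2"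
    using dist_apex_power2[of k 0] by (simp add: dist_commute)
  then show "dist (vector [0, 0]) (apex k) = 1"
    by (rule power2_eq_imp_eq) simp_all
  have "(dist (apex k) (vector [of_rat (r_of k X Y), 0]))^2 = ((of_rat (q_of k X Y))\<^sup>2)^2"
    unfolding dist_apex_power2 cosine_rule_of_point[OF assms, symmetric] by (simp add: of_rat_power)
  then show "dist (apex k) (vector [of_rat (r_of k X Y), 0]) = (of_rat (q_of k X Y))\<^sup>2"
    by (rule power2_eq_imp_eq) simp_all
qed

lemma dist_origin_vector: "dist (vector [0, 0] :: real^2) (vector [r, 0]) = \<bar>r\<bar>"
  by (simp add: dist_vec_def L2_set_def sum_2 dist_real_def)

lemma corresponds_iff:
  assumes "triangle_point k X Y"
  shows "corresponds A B C k X Y \<longleftrightarrow> (\<exists>\<mu>::rat. 0 < \<mu> \<and> side_lengths A B C =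
    image_mset ((*) (of_rat \<mu>)) {#1, (of_rat (q_of k X Y))\<^sup>2, of_rat (r_of k X Y)#})"
  using assms dist_origin_apex[of k X Y] dist_apex_r_of[of k X Y]
  by (simp add: triangle_point_def corresponds_def Let_def dist_origin_vector)

lemma point_of_sides_and_area:
  fixes a b c f :: rat
  assumes pos: "a > 0" "c > 0" "f > 0"
    and heron: "16 * f^2 = 4 * (a^2)^2 * c^2 - ((a^2)^2 + c^2 - (b^2)^2)^2"
  obtains k X Y where "triangle_point k X Y" "r_of k X Y = c / a^2" "(q_of k X Y)^2 = (b / a)^2"
proof -
  define s where "s = ((a^2)^2 + c^2 - (b^2)^2) / (2 * a^2 * c)"
  \<comment> \<open>The negative sign avoids \<open>t = 1\<close>, which no \<open>k\<close> parametrises.\<close>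
  define t where "t = - (2 * f / (a^2 * c))"
  have st: "s^2 + t^2 = 1"
    using cosine_sine_of_sides[OF heron] pos by (simp add: s_def t_def)
  have t: "t < 0" using pos by (simp add: t_def)
  then obtain k where k: "circle_x k = s" "circle_y k = t"
    using unit_circle_param[OF st] by auto
  have "k^4 \<noteq> 1" using t k(2) circle_y_eq_0_iff[of k] by simp
  have r_pos: "c / a^2 > 0" using pos by simp
  have "(b / a)^4 = (c / a^2)^2 - 2 * circle_x k * (c / a^2) + 1"
    using pos unfolding k(1) s_def by (simp add: field_simps flip: power_mult)
  then obtain X Y where XY: "on_curve k X Y" "denom k X \<noteq> 0" "r_of k X Y = c / a^2"
      "(q_of k X Y)^2 = (b / a)^2"
    using point_of_cosine_rule[OF \<open>k^4 \<noteq> 1\<close>, of "c / a^2" "b / a"] r_pos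
    by (metis less_irrefl)
  then have "triangle_point k X Y"
    using \<open>k^4 \<noteq> 1\<close> r_pos by (simp add: triangle_point_def)
  with XY show thesis using that by blast
qed

lemma point_of_heron_triangle:
  fixes A B C :: "real^2"
  assumes heron: "heron_triangle A B C"
    and square: "perfect_square (dist A B)" "perfect_square (dist B C)"
  shows "\<exists>k X Y. triangle_point k X Y \<and> corresponds A B C k X Y"
proof -
  obtain m n :: nat where square_sides: "dist A B = (real m)\<^sup>2" "dist B C = (real n)\<^sup>2"
    using square by (auto simp: perfect_square_def)
  obtain l S :: nat where side_area: "dist C A = real l" "triangle_area A B C = real S"
    using heron by (auto simp: heron_triangle_def side_lengths_def elim!: Nats_cases)
  define a b c f :: rat where "a = of_nat m" and "b = of_nat n" and "c = of_nat l" and "f = of_nat S"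
  have pos: "a > 0" "c > 0" "f > 0"
    using heron square_sides side_area
    by (auto simp: heron_triangle_def side_lengths_def a_def c_def f_def)
  have sides: "dist A B = of_rat (a^2)" "dist B C = of_rat (b^2)" "dist C A = of_rat c"
    and area: "triangle_area A B C = of_rat f"
    using square_sides side_area by (simp_all add: a_def b_def c_def f_def of_rat_power)
  have "(of_rat (16 * f^2) :: real) = of_rat (4 * (a^2)^2 * c^2 - ((a^2)^2 + c^2 - (b^2)^2)^2)"
    using triangle_area_power2[of A B C] unfolding sides area
    by (simp add: of_rat_mult of_rat_power of_rat_diff of_rat_add)
  then have "16 * f^2 = 4 * (a^2)^2 * c^2 - ((a^2)^2 + c^2 - (b^2)^2)^2"
    by (simp only: of_rat_eq_iff)
  then obtain k X Y where point: "triangle_point k X Y"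
    and r: "r_of k X Y = c / a^2" and q: "(q_of k X Y)^2 = (b / a)^2"
    using point_of_sides_and_area[OF pos] by metis
  have "side_lengths A B C = image_mset ((*) (of_rat (a^2)))
      {#1, (of_rat (q_of k X Y))\<^sup>2, of_rat (r_of k X Y)#}"
    unfolding r of_rat_power[symmetric] q
    using pos by (simp add: side_lengths_def sides power_divide flip: of_rat_mult)
  then have "corresponds A B C k X Y"
    unfolding corresponds_iff[OF point] using pos by (intro exI[of _ "a^2"]) simp
  with point show ?thesis by blast
qed

lemma finite_Rats_common_denominator:
  fixes S :: "'a::field_char_0 set"
  assumes "finite S" "S \<subseteq> \<rat>"
  shows "\<exists>n::nat. n > 0 \<and> (\<forall>x\<in>S. of_nat n * x \<in> \<int>)"
  using assms
proof (induction S rule: finite_induct)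
  case empty
  show ?case by auto
next
  case (insert x S)
  then obtain n :: nat where n: "n > 0" "\<forall>y\<in>S. of_nat n * y \<in> \<int>" by auto
  obtain a b where x: "x = of_int a / of_int b" "b > 0"
    using insert.prems by (auto elim!: Rats_cases')
  define m where "m = nat b"
  have m: "m > 0" "of_nat m * x \<in> \<int>" using x by (simp_all add: m_def)
  have "of_nat (n * m) * y \<in> \<int>" if "y \<in> insert x S" for y
  proof (cases "y = x")
    case True
    have "of_nat n * (of_nat m * x) \<in> \<int>" by (rule Ints_mult[OF _ m(2)]) simp
    with True show ?thesis by (simp add: mult_ac)
  next
    case False
    then have "of_nat n * y \<in> \<int>" using n(2) that by simp
    then have "of_nat m * (of_nat n * y) \<in> \<int>" by (rule Ints_mult[rotated]) simp
    then show ?thesis by (simp add: mult_ac)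
  qed
  then show ?case using n(1) m(1) by (intro exI[of _ "n * m"]) simp
qed

lemma perfect_square_power2_Ints:
  assumes "x \<in> \<int>"
  shows "perfect_square (x^2)"
proof -
  obtain i where "x = of_int i" using assms by (elim Ints_cases)
  then have "x^2 = (real (nat \<bar>i\<bar>))\<^sup>2" by simp
  then show ?thesis unfolding perfect_square_def by blast
qed

lemma rational_triangle_scales_to_heron_triangle:
  fixes A B C :: "real^2"
  assumes sides: "dist A B = a^2" "dist B C = b^2"
    and rational: "a \<in> \<rat>" "b \<in> \<rat>" "dist C A \<in> \<rat>"
    and area: "triangle_area A B C \<in> \<rat>" "triangle_area A B C > 0"
  obtains N :: nat where "N > 0"
    "heron_triangle ((real N)\<^sup>2 *\<^sub>R A) ((real N)\<^sup>2 *\<^sub>R B) ((real N)\<^sup>2 *\<^sub>R C)"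
    "two_square_sides ((real N)\<^sup>2 *\<^sub>R A) ((real N)\<^sup>2 *\<^sub>R B) ((real N)\<^sup>2 *\<^sub>R C)"
proof -
  define c f where "c = dist C A" and "f = triangle_area A B C"
  have "{a, b, c, f} \<subseteq> \<rat>" and "f > 0" using rational area by (auto simp: c_def f_def)
  then obtain N :: nat where N: "N > 0" "\<forall>x\<in>{a, b, c, f}. real N * x \<in> \<int>"
    using finite_Rats_common_denominator[of "{a, b, c, f}"] by auto
  define P Q R where "P = (real N)\<^sup>2 *\<^sub>R A" and "Q = (real N)\<^sup>2 *\<^sub>R B" and "R = (real N)\<^sup>2 *\<^sub>R C"
  have dists: "dist P Q = (real N * a)^2" "dist Q R = (real N * b)^2"
      "dist R P = real N * (real N * c)"
    by (simp_all add: P_def Q_def R_def dist_scaleR_scaleR sides c_def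
        power_mult_distrib power2_eq_square)
  have area_PQR: "triangle_area P Q R = real N ^ 3 * (real N * f)"
    by (simp add: P_def Q_def R_def triangle_area_scaleR f_def power2_eq_square power3_eq_cube)
  then have "\<not> collinear {P, Q, R}"
    using triangle_area_eq_0_if_collinear[of P Q R] N(1) \<open>f > 0\<close> by auto
  moreover from this have "P \<noteq> Q" "Q \<noteq> R" "R \<noteq> P" by (auto simp: insert_commute)
  moreover have "dist P Q \<in> \<int>" "dist Q R \<in> \<int>" "dist R P \<in> \<int>"
    unfolding dists using N(2) by (auto intro!: Ints_power Ints_mult)
  moreover have "real N ^ 3 * (real N * f) \<in> \<int>"
    using N(2) by (auto intro!: Ints_mult Ints_power)
  ultimately have "heron_triangle P Q R"
    using N(1) \<open>f > 0\<close> by (simp add: heron_triangle_def side_lengths_def area_PQR Nats_altdef2)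
  moreover have "two_square_sides P Q R"
    using N(2) by (simp add: two_square_sides_def dists perfect_square_power2_Ints)
  ultimately show thesis using that N(1) by (simp add: P_def Q_def R_def)
qed

lemma heron_triangle_of_point:
  fixes k X Y :: rat
  assumes point: "triangle_point k X Y"
  shows "\<exists>A B C. heron_triangle A B C \<and> two_square_sides A B C \<and> corresponds A B C k X Y"
proof -
  define r q t :: real where "r = of_rat (r_of k X Y)" and "q = of_rat (q_of k X Y)"
    and "t = of_rat (circle_y k)"
  define P Q :: "real^2" where "P = vector [0, 0]" and "Q = vector [r, 0]"
  have sides: "dist P (apex k) = 1\<^sup>2" "dist (apex k) Q = q\<^sup>2" "dist P Q = r"
    using point dist_origin_apex[of k X Y] dist_apex_r_of[of k X Y]
    by (simp_all add: triangle_point_def P_def Q_def r_def q_def dist_origin_vector)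
  have "r > 0" "t \<noteq> 0"
    using point by (simp_all add: triangle_point_def r_def t_def circle_y_eq_0_iff)
  have area: "triangle_area P (apex k) Q = r * \<bar>t\<bar> / 2"
    using \<open>r > 0\<close> by (simp add: content_triangle P_def Q_def apex_def t_def circle_y_def abs_mult)
  have "q \<in> \<rat>" "dist Q P \<in> \<rat>" "triangle_area P (apex k) Q \<in> \<rat>"
    unfolding area sides dist_commute[of Q P] by (simp_all add: r_def q_def t_def)
  moreover have "triangle_area P (apex k) Q > 0"
    unfolding area using \<open>r > 0\<close> \<open>t \<noteq> 0\<close> by simp
  ultimately obtain N :: nat where N: "N > 0"
    and heron: "heron_triangle ((real N)\<^sup>2 *\<^sub>R P) ((real N)\<^sup>2 *\<^sub>R apex k) ((real N)\<^sup>2 *\<^sub>R Q)"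
    and square: "two_square_sides ((real N)\<^sup>2 *\<^sub>R P) ((real N)\<^sup>2 *\<^sub>R apex k) ((real N)\<^sup>2 *\<^sub>R Q)"
    using rational_triangle_scales_to_heron_triangle[OF sides(1,2) Rats_1] by auto
  have "side_lengths ((real N)\<^sup>2 *\<^sub>R P) ((real N)\<^sup>2 *\<^sub>R apex k) ((real N)\<^sup>2 *\<^sub>R Q)
      = image_mset ((*) (of_rat ((of_nat N)\<^sup>2))) {#1, q\<^sup>2, r#}"
    by (simp add: side_lengths_scaleR of_rat_power)
      (simp add: side_lengths_def sides dist_commute[of Q P])
  then have "corresponds ((real N)\<^sup>2 *\<^sub>R P) ((real N)\<^sup>2 *\<^sub>R apex k) ((real N)\<^sup>2 *\<^sub>R Q) k X Y"
    unfolding corresponds_iff[OF point] using N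
    by (intro exI[of _ "(of_nat N)\<^sup>2"]) (simp add: q_def r_def)
  with heron square show ?thesis by blast
qed

theorem theorem1p3:
  shows "(\<forall>A B C :: real^2.
            heron_triangle A B C \<and> two_square_sides A B C \<longrightarrow>
            (\<exists>k X Y :: rat. k^4 \<noteq> 1 \<and> nontrivial_point k X Y \<and>
               Y > 2 * k * (3 * X^3 - 2 * (3 * k^4 + 2 * k^2 + 3) * X^2 + 4 * (k^4 - 1)^2 * X
                            - 8 * (k^2 + 1)^2 * (k^2 - 1)^4)
                   / ((X - 2 * (k^2 - 1)^2)^2 + 16 * k^2 * (k^2 - 1)^2) \<and>
               corresponds A B C k X Y)) \<and>
         (\<forall>k X Y :: rat.
            k^4 \<noteq> 1 \<and> nontrivial_point k X Y \<and>
            Y > 2 * k * (3 * X^3 - 2 * (3 * k^4 + 2 * k^2 + 3) * X^2 + 4 * (k^4 - 1)^2 * X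
                         - 8 * (k^2 + 1)^2 * (k^2 - 1)^4)
                / ((X - 2 * (k^2 - 1)^2)^2 + 16 * k^2 * (k^2 - 1)^2) \<longrightarrow>
            (\<exists>A B C :: real^2.
               heron_triangle A B C \<and> two_square_sides A B C \<and> corresponds A B C k X Y))"
  (is "(\<forall>A B C. _ \<longrightarrow> ?corresponding_point A B C) \<and>
    (\<forall>k X Y. ?admissible k X Y \<longrightarrow> ?corresponding_triangle k X Y)")
proof (intro conjI allI impI)
  fix A B C :: "real^2"
  assume "heron_triangle A B C \<and> two_square_sides A B C"
  then obtain k X Y where "triangle_point k X Y" "corresponds A B C k X Y"
    unfolding two_square_sides_def
    by (metis point_of_heron_triangle heron_triangle_rotate corresponds_rotate)
  then show "?corresponding_point A B C"
    unfolding triangle_point_iff_Y_bound by blast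
next
  fix k X Y :: rat
  assume "?admissible k X Y"
  then have "triangle_point k X Y" unfolding triangle_point_iff_Y_bound .
  then show "?corresponding_triangle k X Y" by (rule heron_triangle_of_point)
qed

end
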